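(* There are two absolute constants $c, c_1>0$ such that the following holds. Let $32\le d\le cn$ and let $I,J$ be disjoint subsets of $[n]$ such that $|I|\le d|J|/32$ and $8\le |J|\le 8cn/d$. Let vectors $a^i\in\{0,1\}^n$, $i\in I$, be such that the event $$\mathcal{E}:=\{G\in\mathcal{D}_{n,d}\,:\,\mathcal{N}^{in}_G(i)=\mathrm{supp}\, a^i \text{ for all } i\in I\}$$ has non-zero probability (if $I=\emptyset$, set $\mathcal{E}=\mathcal{D}_{n,d}$). Then for every $v\in\{0,1\}^n$ one has $$\mathbb{P}\{\delta^J(G)=v\mid\mathcal{E}\}\le 2\exp\left(-c_1 d|J|\ln\left(\frac{n}{d|J|}\right)\right).$$
   Context: $[n]=\{1,\dots,n\}$; $n,d$ are positive integers. $\mathcal{D}_{n,d}$ is the set of all $d$-regular directed graphs on the labeled vertex set $[n]$: every vertex has exactly $d$ in-neighbors and $d$ out-neighbors; loops and anti-parallel edges are allowed, multiple edges are not. $\mathbb{P}$ is the uniform probability on $\mathcal{D}_{n,d}$ and $G$ is a uniformly random element of $\mathcal{D}_{n,d}$. For $S\subset[n]$, $\mathcal{N}^{in}_G(S)$ is the set of all vertices $u$ such that $(u,j)$ is an edge of $G$ (directed from $u$ to $j$) for some $j\in S$; $\mathcal{N}^{in}_G(i):=\mathcal{N}^{in}_G(\{i\})$. For $J\subset[n]$ and $i\in[n]$, $\delta^J_i(G)\in\{0,1\}$ equals $1$ if $i\in\mathcal{N}^{in}_G(J)$ and $0$ otherwise, and $\delta^J(G)=(\delta^J_1(G),\dots,\delta^J_n(G))\in\{0,1\}^n$.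 For $a\in\{0,1\}^n$, $\mathrm{supp}\,a=\{k: a_k\ne0\}$. Absolute constants are independent of all parameters. *)

theory Defs
  imports "HOL-Probability.Probability"
begin

text \<open>Vertices are the natural numbers \<open>1, \<dots>, n\<close>. A digraph is identified with its edge relation,
  so loops and anti-parallel edges are possible while multiple edges are not.\<close>

type_synonym digraph = "(nat \<times> nat) set"

definition in_nbrs :: "digraph \<Rightarrow> nat set \<Rightarrow> nat set" where
  "in_nbrs G S = {u. \<exists>j\<in>S. (u, j) \<in> G}"

definition out_nbrs :: "digraph \<Rightarrow> nat set \<Rightarrow> nat set" where
  "out_nbrs G S = {u. \<exists>j\<in>S. (j, u) \<in> G}"

definition regular_digraphs :: "nat \<Rightarrow> nat \<Rightarrow> digraph set" where
  "regular_digraphs n d =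
     {G. G \<subseteq> {1..n} \<times> {1..n} \<and>
         (\<forall>i\<in>{1..n}. card (in_nbrs G {i}) = d \<and> card (out_nbrs G {i}) = d)}"

text \<open>The uniform distribution. \<^const>\<open>pmf_of_set\<close> is only meaningful for a nonempty finite set;
  the set of \<open>d\<close>-regular digraphs on \<open>n\<close> vertices is always finite, and it is nonempty
  precisely when \<open>d \<le> n\<close> or \<open>n = 0\<close>.\<close>

definition random_digraph :: "nat \<Rightarrow> nat \<Rightarrow> digraph pmf" where
  "random_digraph n d = pmf_of_set (regular_digraphs n d)"

text \<open>Vectors indexed by \<open>1, \<dots>, n\<close> are functions that are \<^const>\<open>undefined\<close> outside the index
  range, so that equality of functions is equality of vectors.\<close>

definition bit_vectors :: "nat \<Rightarrow> (nat \<Rightarrow> nat) set" where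
  "bit_vectors n = {1..n} \<rightarrow>\<^sub>E {0, 1}"

definition supp :: "nat \<Rightarrow> (nat \<Rightarrow> nat) \<Rightarrow> nat set" where
  "supp n a = {k \<in> {1..n}. a k \<noteq> 0}"

definition delta :: "nat \<Rightarrow> nat set \<Rightarrow> digraph \<Rightarrow> nat \<Rightarrow> nat" where
  "delta n J G = (\<lambda>i\<in>{1..n}. if i \<in> in_nbrs G J then 1 else 0)"

definition nbr_event :: "nat \<Rightarrow> nat \<Rightarrow> nat set \<Rightarrow> (nat \<Rightarrow> nat \<Rightarrow> nat) \<Rightarrow> digraph set" where
  "nbr_event n d I a = {G \<in> regular_digraphs n d. \<forall>i\<in>I. in_nbrs G {i} = supp n (a i)}"

end

theory Submission imports Defs begin

text \<open>Fix \<open>V = supp v\<close> and write \<open>m = |J|\<close>. Sort the graphs of the event into layers: layer \<open>t\<close>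
  consists of the graphs in which exactly \<open>t\<close> vertices outside \<open>V\<close> send an edge into \<open>J\<close>, each of
  them exactly one. The graphs with \<open>\<delta>\<^sup>J = v\<close> lie in layer \<open>0\<close>. Switching \<open>(u, j), (u', j')\<close> to
  \<open>(u, j'), (u', j)\<close>, where \<open>u \<in> V\<close>, \<open>j \<in> J\<close>, the vertex \<open>u' \<notin> V\<close> sends no edge into \<open>J\<close>, and
  \<open>j' \<notin> I \<union> J\<close> is not an out-neighbour of \<open>u\<close>, moves a graph from layer \<open>t\<close> to layer \<open>t + 1\<close>.
  Such a switching can be chosen in at least \<open>(dm - t) dn / 2\<close> ways
  and undone in at most \<open>(t + 1) |V| d\<close> ways, so as long as \<open>2t < dm\<close> consecutive layers grow by a
  factor of at least \<open>n / (2dm)\<close>. About \<open>dm / 2\<close> such steps give the bound.\<close>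

section \<open>Neighbourhoods and edge counts in regular digraphs\<close>

lemma in_nbrs_singleton: "in_nbrs G {i} = {u. (u, i) \<in> G}"
  by (simp add: in_nbrs_def)

lemma out_nbrs_singleton: "out_nbrs G {i} = {w. (i, w) \<in> G}"
  by (simp add: out_nbrs_def)

lemma regular_digraphsD:
  assumes "G \<in> regular_digraphs n d"
  shows "G \<subseteq> {1..n} \<times> {1..n}" "finite G"
    and "i \<in> {1..n} \<Longrightarrow> card (in_nbrs G {i}) = d"
    and "i \<in> {1..n} \<Longrightarrow> card (out_nbrs G {i}) = d"
  using assms finite_subset[of G "{1..n} \<times> {1..n}"] by (auto simp: regular_digraphs_def)

lemma finite_regular_digraphs: "finite (regular_digraphs n d)"
  by (rule finite_subset[of _ "Pow ({1..n} \<times> {1..n})"]) (auto simp: regular_digraphs_def)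

lemma nbrs_subset:
  assumes "G \<in> regular_digraphs n d"
  shows "in_nbrs G S \<subseteq> {1..n}" "out_nbrs G S \<subseteq> {1..n}"
  using regular_digraphsD(1)[OF assms] by (auto simp: in_nbrs_def out_nbrs_def)

lemma finite_nbrs:
  assumes "G \<in> regular_digraphs n d"
  shows "finite (in_nbrs G S)" "finite (out_nbrs G S)"
  using nbrs_subset[OF assms, THEN finite_subset] by simp_all

lemma card_edges_from:
  assumes G: "G \<in> regular_digraphs n d" and A: "A \<subseteq> {1..n}"
  shows "card (G \<inter> A \<times> UNIV) = card A * d"
proof -
  have "G \<inter> A \<times> UNIV = (SIGMA a:A. out_nbrs G {a})"
    by (auto simp: out_nbrs_singleton)
  moreover have "finite A" "\<forall>a\<in>A. finite (out_nbrs G {a})"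
    using A finite_nbrs(2)[OF G] by (auto intro: finite_subset)
  ultimately have "card (G \<inter> A \<times> UNIV) = (\<Sum>a\<in>A. card (out_nbrs G {a}))"
    by (simp add: card_SigmaI)
  also have "\<dots> = (\<Sum>a\<in>A. d)"
    using A regular_digraphsD(4)[OF G] by (intro sum.cong) auto
  finally show ?thesis by simp
qed

lemma card_edges_into:
  assumes G: "G \<in> regular_digraphs n d" and A: "A \<subseteq> {1..n}"
  shows "card (G \<inter> UNIV \<times> A) = card A * d"
proof -
  have "G \<inter> UNIV \<times> A = prod.swap ` (SIGMA a:A. in_nbrs G {a})"
    by (auto simp: in_nbrs_singleton image_iff)
  moreover have "finite A" "\<forall>a\<in>A. finite (in_nbrs G {a})"
    using A finite_nbrs(1)[OF G] by (auto intro: finite_subset)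
  ultimately have "card (G \<inter> UNIV \<times> A) = (\<Sum>a\<in>A. card (in_nbrs G {a}))"
    by (simp add: card_image card_SigmaI)
  also have "\<dots> = (\<Sum>a\<in>A. d)"
    using A regular_digraphsD(3)[OF G] by (intro sum.cong) auto
  finally show ?thesis by simp
qed

lemma card_in_nbrs_le:
  assumes "G \<in> regular_digraphs n d" "J \<subseteq> {1..n}"
  shows "card (in_nbrs G J) \<le> d * card J"
proof -
  have "in_nbrs G J = fst ` (G \<inter> UNIV \<times> J)"
    by (force simp: in_nbrs_def image_iff)
  thus ?thesis
    using card_edges_into[OF assms] regular_digraphsD(2)[OF assms(1)]
      card_image_le[of "G \<inter> UNIV \<times> J" fst] by (simp add: mult.commute)
qed

section \<open>The switching operation\<close>

fun switch :: "nat \<times> nat \<times> nat \<times> nat \<Rightarrow> digraph \<Rightarrow> digraph" where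
  "switch (u, j, u', j') G = (G - {(u, j), (u', j')}) \<union> {(u, j'), (u', j)}"

fun switchable :: "digraph \<Rightarrow> nat \<times> nat \<times> nat \<times> nat \<Rightarrow> bool" where
  "switchable G (u, j, u', j') \<longleftrightarrow> (u, j) \<in> G \<and> (u', j') \<in> G \<and> (u, j') \<notin> G \<and> (u', j) \<notin> G"

lemma in_nbrs_switch:
  assumes "switchable G (u, j, u', j')"
  shows "in_nbrs (switch (u, j, u', j') G) {i} =
    (if i = j then insert u' (in_nbrs G {j} - {u})
     else if i = j' then insert u (in_nbrs G {j'} - {u'}) else in_nbrs G {i})"
  using assms by (auto simp: in_nbrs_singleton)

lemma out_nbrs_switch:
  assumes "switchable G (u, j, u', j')"
  shows "out_nbrs (switch (u, j, u', j') G) {i} =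
    (if i = u then insert j' (out_nbrs G {u} - {j})
     else if i = u' then insert j (out_nbrs G {u'} - {j'}) else out_nbrs G {i})"
  using assms by (auto simp: out_nbrs_singleton)

lemma card_exchange: "finite A \<Longrightarrow> x \<in> A \<Longrightarrow> y \<notin> A \<Longrightarrow> card (insert y (A - {x})) = card A"
  by (metis Diff_iff card_Suc_Diff1 card_insert_disjoint finite_Diff)

text \<open>Each neighbourhood that changes loses one member and gains one. The two non-edges in
  \<open>switchable\<close> ensure that the gained vertex is new, so no degree changes.\<close>

lemma switch_regular:
  assumes G: "G \<in> regular_digraphs n d" and sw: "switchable G q"
  shows "switch q G \<in> regular_digraphs n d"
proof -
  obtain u j u' j' where q: "q = (u, j, u', j')" by (cases q)
  note fin = finite_nbrs[OF G]
  have sub: "switch q G \<subseteq> {1..n} \<times> {1..n}"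
    using regular_digraphsD(1)[OF G] sw by (auto simp: q)
  have mem: "u \<in> in_nbrs G {j}" "u' \<notin> in_nbrs G {j}" "u' \<in> in_nbrs G {j'}" "u \<notin> in_nbrs G {j'}"
    "j \<in> out_nbrs G {u}" "j' \<notin> out_nbrs G {u}" "j' \<in> out_nbrs G {u'}" "j \<notin> out_nbrs G {u'}"
    using sw by (auto simp: q in_nbrs_singleton out_nbrs_singleton)
  have "card (in_nbrs (switch q G) {i}) = card (in_nbrs G {i})"
    and "card (out_nbrs (switch q G) {i}) = card (out_nbrs G {i})" for i
    unfolding q in_nbrs_switch[OF sw[unfolded q]] out_nbrs_switch[OF sw[unfolded q]]
    using mem by (simp_all only: card_exchange fin simp_thms split: if_split) auto
  with sub show ?thesis
    using G unfolding regular_digraphs_def by auto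
qed

text \<open>For fixed \<open>q\<close> only four pairs are touched, and \<open>switchable\<close>
  prescribes which of them belonged to the graph beforehand.\<close>

lemma switch_injective:
  "switchable G q \<Longrightarrow> switchable H q \<Longrightarrow> switch q G = switch q H \<Longrightarrow> G = H"
  by (cases q) (auto simp: set_eq_iff; metis)

section \<open>Layers and the switchings between them\<close>

definition layer ::
  "nat \<Rightarrow> nat \<Rightarrow> nat set \<Rightarrow> (nat \<Rightarrow> nat \<Rightarrow> nat) \<Rightarrow> nat set \<Rightarrow> nat set \<Rightarrow> nat \<Rightarrow> digraph set" where
  "layer n d I a J V t = {G \<in> nbr_event n d I a. card (in_nbrs G J - V) = t \<and>
     (\<forall>u\<in>in_nbrs G J - V. card (out_nbrs G {u} \<inter> J) = 1)}"

text \<open>Each exclusion has its purpose: \<open>u'\<close> sends no edge into \<open>J\<close>,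
  so it is new there and gets exactly one; \<open>j'\<close> avoids \<open>I\<close>, so the event
  is preserved, avoids \<open>J\<close>, so no other edge into \<open>J\<close> is affected, and
  avoids \<open>out_nbrs G {u}\<close>, so no double edge arises.\<close>

definition switchings :: "nat set \<Rightarrow> nat set \<Rightarrow> nat set \<Rightarrow> digraph \<Rightarrow> (nat \<times> nat \<times> nat \<times> nat) set" where
  "switchings I J V G = {(u, j, u', j'). (u, j) \<in> G \<inter> V \<times> J \<and>
     (u', j') \<in> G - (V \<union> in_nbrs G J) \<times> UNIV - UNIV \<times> (I \<union> J \<union> out_nbrs G {u})}"

text \<open>These are necessary conditions for \<open>q\<close> to have led to \<open>G\<close>, not
  sufficient ones. The set serves only for an upper bound, so overcounting is harmless.\<close>

definition back_switchings :: "nat set \<Rightarrow> nat set \<Rightarrow> digraph \<Rightarrow> (nat \<times> nat \<times> nat \<times> nat) set" where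
  "back_switchings J V G = {(u, j, u', j'). u \<in> V \<and> (u, j') \<in> G \<and>
     u' \<in> in_nbrs G J - V \<and> j \<in> out_nbrs G {u'} \<inter> J}"

lemma layer_regular: "G \<in> layer n d I a J V t \<Longrightarrow> G \<in> regular_digraphs n d"
  by (simp add: layer_def nbr_event_def)

lemma finite_nbr_event: "finite (nbr_event n d I a)"
  using finite_regular_digraphs by (rule rev_finite_subset) (auto simp: nbr_event_def)

lemma finite_layer: "finite (layer n d I a J V t)"
  using finite_nbr_event by (rule rev_finite_subset) (auto simp: layer_def)

lemma switchings_switchable: "q \<in> switchings I J V G \<Longrightarrow> switchable G q"
  by (cases q) (auto simp: switchings_def in_nbrs_def out_nbrs_singleton)

text \<open>Only \<open>j\<close> and \<open>j'\<close> change their in-neighbours, and neither lies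
  in \<open>I\<close>. Outside \<open>V\<close>, only \<open>u'\<close> changes its out-neighbours,
  and it joins the vertices sending an edge into \<open>J\<close>, with \<open>j\<close> as its sole
  target there.\<close>

lemma switch_layer:
  assumes G: "G \<in> layer n d I a J V t" and q: "q \<in> switchings I J V G" and "I \<inter> J = {}"
  shows "switch q G \<in> layer n d I a J V (Suc t)" "q \<in> back_switchings J V (switch q G)"
proof -
  obtain u j u' j' where qq: "q = (u, j, u', j')" by (cases q)
  note sw = switchings_switchable[OF q, unfolded qq]
  have *: "(u, j) \<in> G" "u \<in> V" "j \<in> J" "(u', j') \<in> G" "u' \<notin> V" "u' \<notin> in_nbrs G J"
     "j' \<notin> I" "j' \<notin> J" "(u, j') \<notin> G"
    using q by (auto simp: switchings_def qq out_nbrs_singleton)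
  let ?H = "switch q G"
  have H: "?H \<in> regular_digraphs n d"
    by (rule switch_regular[OF layer_regular[OF G] switchings_switchable[OF q]])
  have ev: "?H \<in> nbr_event n d I a"
    using G H * \<open>I \<inter> J = {}\<close> in_nbrs_switch[OF sw] unfolding layer_def nbr_event_def qq by auto
  have diff: "in_nbrs ?H J - V = insert u' (in_nbrs G J - V)"
    using * by (auto simp: in_nbrs_def qq)
  note fin = finite_nbrs(1)[OF layer_regular[OF G], of J]
  have old: "card (in_nbrs G J - V) = t" "\<forall>w\<in>in_nbrs G J - V. card (out_nbrs G {w} \<inter> J) = 1"
    using G by (auto simp: layer_def)
  have new: "out_nbrs ?H {u'} \<inter> J = {j}"
    using * by (auto simp: qq out_nbrs_singleton in_nbrs_def)
  have "out_nbrs ?H {w} \<inter> J = out_nbrs G {w} \<inter> J" if "w \<in> in_nbrs G J - V" for w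
    using * that by (auto simp: qq out_nbrs_singleton)
  then have "\<forall>w\<in>in_nbrs ?H J - V. card (out_nbrs ?H {w} \<inter> J) = 1"
    using old new unfolding diff by auto
  moreover have "card (in_nbrs ?H J - V) = Suc t"
    using diff * fin old by simp
  ultimately show "?H \<in> layer n d I a J V (Suc t)"
    using ev by (simp add: layer_def)
  show "q \<in> back_switchings J V ?H"
    using * new diff by (auto simp: back_switchings_def qq)
qed

section \<open>Counting switchings in both directions\<close>

lemma card_le_Diff2:
  "card A \<le> card (A - B - C) + card (A \<inter> B) + card (A \<inter> C)"
proof -
  have "card A = card ((A - B - C) \<union> (A \<inter> B) \<union> (A \<inter> C))"
    by (rule arg_cong[of _ _ card]) auto
  also have "\<dots> \<le> card ((A - B - C) \<union> (A \<inter> B)) + card (A \<inter> C)"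
    by (rule card_Un_le)
  also have "\<dots> \<le> card (A - B - C) + card (A \<inter> B) + card (A \<inter> C)"
    by (intro add_right_mono card_Un_le)
  finally show ?thesis .
qed

text \<open>Of the \<open>d * card J\<close> edges into \<open>J\<close>, exactly \<open>t\<close>
  start outside \<open>V\<close>, one per vertex; the others can serve as \<open>(u, j)\<close>. For
  each of these, \<open>small\<close> says that the exclusions rule out at most half of the
  \<open>d * n\<close> edges as \<open>(u', j')\<close>.\<close>

lemma card_switchings_ge:
  assumes G: "G \<in> layer n d I a J V t"
    and sub: "I \<subseteq> {1..n}" "J \<subseteq> {1..n}" "V \<subseteq> {1..n}"
    and small: "2 * (card V + t + card I + card J + d) \<le> n"
  shows "(d * card J - t) * (d * n) \<le> 2 * card (switchings I J V G)"
proof -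
  note R = layer_regular[OF G]
  note finG = regular_digraphsD(2)[OF R]
  define N where "N = in_nbrs G J"
  have N: "card (N - V) = t" "\<forall>u\<in>N - V. card (out_nbrs G {u} \<inter> J) = 1" "N \<subseteq> {1..n}"
    using G nbrs_subset(1)[OF R] by (auto simp: layer_def N_def)
  have finN: "finite (N - V)" and fins: "finite I" "finite J" "finite V"
    using N(3) sub by (auto intro: finite_subset)
  \<comment> \<open>\<open>C u\<close> holds the admissible second edges. It depends on the first
    edge only through its source, hence \<open>fst e\<close> in the sum below.\<close>
  define C where "C u = G - (V \<union> N) \<times> UNIV - UNIV \<times> (I \<union> J \<union> out_nbrs G {u})" for u
  have C: "d * n \<le> 2 * card (C u)" if "u \<in> V" for u
  proof -
    have u: "u \<in> {1..n}" using that sub by auto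
    have "card (V \<union> N) \<le> card V + t"
      using card_Un_le[of V "N - V"] N(1) by simp
    moreover have "card (I \<union> J \<union> out_nbrs G {u}) \<le> card I + card J + d"
      using card_Un_le[of "I \<union> J" "out_nbrs G {u}"] card_Un_le[of I J]
        regular_digraphsD(4)[OF R u] by simp
    ultimately have le: "card (V \<union> N) + card (I \<union> J \<union> out_nbrs G {u})
        \<le> card V + t + card I + card J + d" by simp
    have "G \<inter> {1..n} \<times> UNIV = G" using regular_digraphsD(1)[OF R] by auto
    then have "n * d = card G" using card_edges_from[OF R, of "{1..n}"] by simp
    also have "\<dots> \<le> card (C u) + card (G \<inter> (V \<union> N) \<times> UNIV)
        + card (G \<inter> UNIV \<times> (I \<union> J \<union> out_nbrs G {u}))"
      unfolding C_def by (rule card_le_Diff2)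
    also have "\<dots> = card (C u) + (card (V \<union> N) + card (I \<union> J \<union> out_nbrs G {u})) * d"
      using card_edges_from[OF R, of "V \<union> N"] N(3) sub nbrs_subset(2)[OF R]
        card_edges_into[OF R, of "I \<union> J \<union> out_nbrs G {u}"] by (simp add: algebra_simps)
    also have "\<dots> \<le> card (C u) + (card V + t + card I + card J + d) * d"
      using le by simp
    finally have "2 * (n * d) \<le> 2 * card (C u) + (2 * (card V + t + card I + card J + d)) * d"
      by (simp add: algebra_simps)
    also have "\<dots> \<le> 2 * card (C u) + n * d"
      using small by (intro add_left_mono mult_right_mono) auto
    finally show ?thesis by (simp add: mult.commute)
  qed
  have "card (G \<inter> (N - V) \<times> J) = t"
  proof -
    have "G \<inter> (N - V) \<times> J = (SIGMA w:N - V. out_nbrs G {w} \<inter> J)"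
      by (auto simp: out_nbrs_singleton)
    then show ?thesis using N finN fins by (simp add: card_SigmaI)
  qed
  moreover have "G \<inter> UNIV \<times> J = G \<inter> V \<times> J \<union> G \<inter> (N - V) \<times> J"
    by (auto simp: N_def in_nbrs_def)
  then have "card (G \<inter> UNIV \<times> J) = card (G \<inter> V \<times> J) + card (G \<inter> (N - V) \<times> J)"
    using finG by (auto intro!: card_Un_disjoint)
  ultimately have VJ: "card (G \<inter> V \<times> J) = d * card J - t"
    using card_edges_into[OF R sub(2)] by (simp add: mult.commute)
  have "switchings I J V G = (\<lambda>((u, j), (u', j')). (u, j, u', j')) ` (SIGMA e:G \<inter> V \<times> J. C (fst e))"
    by (auto simp: switchings_def C_def N_def image_iff Bex_def)
  moreover have "inj_on (\<lambda>((u, j), (u', j')). (u, j, u', j')) (SIGMA e:G \<inter> V \<times> J. C (fst e))"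
    by (auto simp: inj_on_def)
  ultimately have "card (switchings I J V G) = (\<Sum>e\<in>G \<inter> V \<times> J. card (C (fst e)))"
    using finG by (simp add: card_image card_SigmaI C_def)
  moreover have "(\<Sum>e\<in>G \<inter> V \<times> J. d * n) \<le> (\<Sum>e\<in>G \<inter> V \<times> J. 2 * card (C (fst e)))"
    using C by (intro sum_mono) auto
  ultimately show ?thesis by (simp add: VJ sum_distrib_left)
qed

text \<open>There are \<open>t\<close> choices of \<open>u'\<close>; the single-edge condition in
  \<open>layer\<close> then forces \<open>j\<close>, and \<open>(u, j')\<close> is one of the
  \<open>card V * d\<close> edges leaving \<open>V\<close>.\<close>

lemma card_back_switchings_le:
  assumes G: "G \<in> layer n d I a J V t" and V: "V \<subseteq> {1..n}" and J: "J \<subseteq> {1..n}"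
  shows "finite (back_switchings J V G)" "card (back_switchings J V G) \<le> t * (card V * d)"
proof -
  note R = layer_regular[OF G]
  define N where "N = in_nbrs G J"
  define S where "S = (SIGMA w:N - V. out_nbrs G {w} \<inter> J) \<times> (G \<inter> V \<times> UNIV)"
  have N: "card (N - V) = t" "\<forall>u\<in>N - V. card (out_nbrs G {u} \<inter> J) = 1"
    using G by (auto simp: layer_def N_def)
  have fin: "finite N" "finite J"
    using finite_nbrs(1)[OF R] J by (auto simp: N_def intro: finite_subset)
  have finS: "finite S"
    using fin regular_digraphsD(2)[OF R] by (auto simp: S_def)
  have "card S = t * (card V * d)"
    using N fin card_edges_from[OF R V] by (simp add: S_def card_cartesian_product card_SigmaI)
  moreover have eq: "back_switchings J V G = (\<lambda>((u', j), (u, j')). (u, j, u', j')) ` S"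
    by (auto simp: back_switchings_def S_def N_def image_iff Bex_def)
  ultimately show "card (back_switchings J V G) \<le> t * (card V * d)"
    using card_image_le[OF finS] by metis
  show "finite (back_switchings J V G)"
    using finS eq by simp
qed

text \<open>Keeping \<open>q\<close> in the pair makes \<open>(G, q)\<close> to
  \<open>(switch q G, q)\<close> injective, so forward pairs from layer \<open>t\<close> are at most
  as many as backward pairs from layer \<open>Suc t\<close>.\<close>

lemma card_layer_double_count:
  assumes sub: "I \<subseteq> {1..n}" "J \<subseteq> {1..n}" "V \<subseteq> {1..n}" and disj: "I \<inter> J = {}"
    and small: "2 * (card V + t + card I + card J + d) \<le> n"
  shows "card (layer n d I a J V t) * ((d * card J - t) * (d * n))
    \<le> 2 * card (layer n d I a J V (Suc t)) * (Suc t * (card V * d))"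
proof -
  let ?L = "layer n d I a J V"
  define A where "A = (SIGMA G:?L t. switchings I J V G)"
  define B where "B = (SIGMA G:?L (Suc t). back_switchings J V G)"
  have "finite B"
    using card_back_switchings_le(1)[OF _ sub(3,2)] finite_layer by (auto simp: B_def)
  have fs: "finite (switchings I J V G)" if "G \<in> ?L t" for G
    by (rule finite_subset[of _ "(\<lambda>((u, j), (u', j')). (u, j, u', j')) ` (G \<times> G)"])
      (use regular_digraphsD(2)[OF layer_regular[OF that]] in
        \<open>auto simp: switchings_def image_iff Bex_def\<close>)
  have "inj_on (\<lambda>(G, q). (switch q G, q)) A"
  proof (rule inj_onI)
    fix p p' assume "p \<in> A" "p' \<in> A" "(\<lambda>(G, q). (switch q G, q)) p = (\<lambda>(G, q). (switch q G, q)) p'"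
    moreover obtain G q H r where "p = (G, q)" "p' = (H, r)"
      by (metis surj_pair)
    ultimately show "p = p'"
      by (simp add: A_def del: switch.simps)
        (metis switch_injective[OF switchings_switchable switchings_switchable])
  qed
  moreover have "(\<lambda>(G, q). (switch q G, q)) ` A \<subseteq> B"
    using switch_layer[OF _ _ disj] by (auto simp: A_def B_def)
  ultimately have AB: "card A \<le> card B"
    using \<open>finite B\<close> by (rule card_inj_on_le)
  have "card (?L t) * ((d * card J - t) * (d * n)) = (\<Sum>G\<in>?L t. (d * card J - t) * (d * n))"
    by simp
  also have "\<dots> \<le> (\<Sum>G\<in>?L t. 2 * card (switchings I J V G))"
    by (intro sum_mono card_switchings_ge[OF _ sub small])
  also have "\<dots> = 2 * card A"
    unfolding A_def using fs finite_layer by (simp add: card_SigmaI sum_distrib_left)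
  also have "\<dots> \<le> 2 * card B"
    using AB by simp
  also have "card B = (\<Sum>G\<in>?L (Suc t). card (back_switchings J V G))"
    unfolding B_def using card_back_switchings_le(1)[OF _ sub(3,2)] finite_layer
    by (intro card_SigmaI) auto
  also have "\<dots> \<le> (\<Sum>G\<in>?L (Suc t). Suc t * (card V * d))"
    by (intro sum_mono card_back_switchings_le(2)[OF _ sub(3,2)])
  finally show ?thesis by (simp add: mult.assoc)
qed

section \<open>Geometric growth of the layers\<close>

lemma card_layer_step:
  assumes sub: "I \<subseteq> {1..n}" "J \<subseteq> {1..n}" "V \<subseteq> {1..n}" and disj: "I \<inter> J = {}"
    and small: "2 * (card V + t + card I + card J + d) \<le> n"
    and pos: "d > 0" and t: "2 * t < d * card J"
  shows "real (card (layer n d I a J V t))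
    \<le> (2 * real (card V) / real n) * real (card (layer n d I a J V (Suc t)))"
proof -
  let ?L = "\<lambda>t. card (layer n d I a J V t)"
  have "n > 0" using small pos by (cases "n = 0") simp_all
  \<comment> \<open>Since \<open>2 * t < d * card J\<close>, the forward factor
    \<open>d * card J - t\<close> is at least \<open>Suc t\<close>, which then cancels against the
    backward count.\<close>
  have "Suc t * (?L t * (d * n)) \<le> (d * card J - t) * (?L t * (d * n))"
    using t by (intro mult_right_mono) auto
  also have "\<dots> \<le> 2 * ?L (Suc t) * (Suc t * (card V * d))"
    using card_layer_double_count[OF sub disj small, of a] by (simp add: algebra_simps)
  finally have "(Suc t * d) * (?L t * n) \<le> (Suc t * d) * (2 * card V * ?L (Suc t))"
    by (simp only: ac_simps)
  then have "?L t * n \<le> 2 * card V * ?L (Suc t)"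
    using pos by (simp only: mult_le_cancel1) simp
  then have "real (?L t * n) \<le> real (2 * card V * ?L (Suc t))"
    by (rule of_nat_mono)
  then show ?thesis using \<open>n > 0\<close> by (simp add: field_simps)
qed

lemma card_layer_0_le:
  assumes sub: "I \<subseteq> {1..n}" "J \<subseteq> {1..n}" "V \<subseteq> {1..n}" and disj: "I \<inter> J = {}"
    and small: "2 * (card V + s + card I + card J + d) \<le> n"
    and pos: "d > 0" and s: "2 * s \<le> d * card J"
  shows "real (card (layer n d I a J V 0))
    \<le> (2 * real (card V) / real n) ^ s * real (card (nbr_event n d I a))"
proof -
  have "real (card (layer n d I a J V 0))
    \<le> (2 * real (card V) / real n) ^ t * real (card (layer n d I a J V t))" if "t \<le> s" for t
    using that
  proof (induction t)
    case (Suc t)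
    let ?x = "2 * real (card V) / real n"
    have "real (card (layer n d I a J V t)) \<le> ?x * real (card (layer n d I a J V (Suc t)))"
      using Suc.prems small s by (intro card_layer_step sub disj pos) auto
    then have "?x ^ t * real (card (layer n d I a J V t))
        \<le> ?x ^ t * (?x * real (card (layer n d I a J V (Suc t))))"
      by (rule mult_left_mono) simp
    with Suc show ?case by (simp add: mult_ac)
  qed simp
  \<comment> \<open>Layer \<open>s\<close> is bounded by the whole event.\<close>
  from this[of s] show ?thesis
    by (rule order.trans[OF _ mult_left_mono])
      (auto intro!: card_mono finite_nbr_event simp: layer_def)
qed

section \<open>From layer sizes to conditional probabilities\<close>

lemma in_nbrs_eq_supp:
  assumes "G \<in> regular_digraphs n d" "delta n J G = v"
  shows "in_nbrs G J = supp n v"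
  using nbrs_subset(1)[OF assms(1), of J] assms(2) by (auto simp: delta_def supp_def split: if_splits)

text \<open>Under the uniform law, conditioning reduces to a ratio of cardinalities. The nonzero
  probability also yields a regular digraph, so that \<open>pmf_of_set\<close> is
  meaningful.\<close>

lemma cond_prob_random_digraph:
  assumes "measure_pmf.prob (random_digraph n d) (nbr_event n d I a) \<noteq> 0"
  shows "\<P>(G in measure_pmf (random_digraph n d). P G \<bar> G \<in> nbr_event n d I a)
    = real (card {G \<in> nbr_event n d I a. P G}) / real (card (nbr_event n d I a))"
proof -
  let ?R = "regular_digraphs n d" and ?E = "nbr_event n d I a"
  have sub: "?E \<subseteq> ?R" by (auto simp: nbr_event_def)
  have ne: "?R \<noteq> {}" using assms sub by auto
  have eqs: "?R \<inter> {G. P G \<and> G \<in> ?E} = {G \<in> ?E. P G}" "?R \<inter> ?E = ?E"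
    using sub by auto
  have "card ?R > 0" using ne finite_regular_digraphs by (simp add: card_gt_0_iff)
  then show ?thesis
    unfolding cond_prob_def random_digraph_def
    by (simp add: measure_pmf_of_set[OF ne finite_regular_digraphs] eqs)
qed

text \<open>For \<open>x\<close> \<le> 1/4 the factor 2 is absorbed by \<open>2 * x\<close> \<le>
  \<open>sqrt x\<close>. The constant 1/8 is 1/2 from the square root times 1/4 from rounding in
  \<open>k div 2\<close>.\<close>

lemma power_div2_le_exp:
  fixes k :: nat and x :: real
  assumes "2 \<le> k" "0 < x" "x \<le> 1 / 4"
  shows "(2 * x) ^ (k div 2) \<le> exp (- (1 / 8) * real k * ln (1 / x))"
proof -
  have "4 * x * x \<le> 1 * x" using assms by (intro mult_right_mono) auto
  then have "(2 * x)\<^sup>2 \<le> x" by (simp add: power2_eq_square)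
  then have "2 * x \<le> sqrt x" by (rule real_le_rsqrt)
  also have "sqrt x = exp (ln (sqrt x))"
    using assms(2) by simp
  also have "ln (sqrt x) = ln x / 2"
    using assms(2) by (simp add: ln_sqrt)
  finally have "(2 * x) ^ (k div 2) \<le> exp (ln x / 2) ^ (k div 2)"
    using assms(2) by (intro power_mono) auto
  also have "\<dots> = exp (real (k div 2) * (ln x / 2))"
    by (rule exp_of_nat_mult[symmetric])
  also have "\<dots> \<le> exp (real k / 4 * (ln x / 2))"
  proof -
    \<comment> \<open>From \<open>k\<close> \<ge> 2: \<open>k div 2\<close> is at least
      \<open>(k - 1) / 2\<close>, hence at least \<open>k / 4\<close>.\<close>
    have "real k / 4 \<le> real (k div 2)"
      using assms(1) by linarith
    moreover have "ln x / 2 \<le> 0" using assms by simp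
    ultimately show ?thesis by (simp only: exp_le_cancel_iff mult_right_mono_neg)
  qed
  finally show ?thesis using assms(2) by (simp add: ln_div)
qed

lemma cond_prob_delta_le:
  fixes n d :: nat
  assumes d: "32 \<le> d" "real d \<le> 1 / 64 * real n"
    and sub: "I \<subseteq> {1..n}" "J \<subseteq> {1..n}" and disj: "I \<inter> J = {}"
    and I: "real (card I) \<le> real d * real (card J) / 32"
    and J: "8 \<le> card J" "real (card J) \<le> 8 * (1 / 64) * real n / real d"
    and E: "measure_pmf.prob (random_digraph n d) (nbr_event n d I a) \<noteq> 0"
  shows "\<P>(G in measure_pmf (random_digraph n d). delta n J G = v \<bar> G \<in> nbr_event n d I a)
    \<le> exp (- (1 / 8) * real d * real (card J) * ln (real n / (real d * real (card J))))"
proof -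
  let ?E = "nbr_event n d I a"
  define F where "F = {G \<in> ?E. delta n J G = v}"
  define V where "V = supp n v"
  define k where "k = d * card J"
  define x where "x = real k / real n"
  have n: "real n > 0" using d by simp
  have k: "real d * real (card J) = real k" by (simp add: k_def)
  \<comment> \<open>Here 8 times 1/64 is 1/8. So \<open>x\<close> is at most 1/8, within the range
    of \<open>power_div2_le_exp\<close>.\<close>
  have kn: "8 * real k \<le> real n"
    using J(2) d(1) by (simp add: k_def field_simps)
  have k2: "k \<ge> 2" using mult_le_mono[OF d(1) J(1)] by (simp add: k_def)
  have "real (card F) / real (card ?E) \<le> (2 * x) ^ (k div 2)"
  \<comment> \<open>The bound \<open>card V\<close> \<le> \<open>k\<close> comes from a graph
    realising \<open>v\<close>, so the case without such a graph is separate.\<close>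
  proof (cases "F = {}")
    case True
    then show ?thesis by (simp add: x_def)
  next
    case False
    then obtain G where G: "G \<in> regular_digraphs n d" "delta n J G = v"
      by (auto simp: F_def nbr_event_def)
    have V: "card V \<le> k"
      using card_in_nbrs_le[OF G(1) sub(2)] in_nbrs_eq_supp[OF G] by (simp add: V_def k_def)
    have "F \<subseteq> layer n d I a J V 0"
      using in_nbrs_eq_supp by (auto simp: F_def V_def layer_def nbr_event_def)
    then have "real (card F) \<le> real (card (layer n d I a J V 0))"
      by (simp add: card_mono finite_layer)
    also have "\<dots> \<le> (2 * real (card V) / real n) ^ (k div 2) * real (card ?E)"
    proof (rule card_layer_0_le[OF sub _ disj])
      show "V \<subseteq> {1..n}" by (auto simp: V_def supp_def)
      have "32 * card J \<le> k" using d(1) by (simp add: k_def)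
      moreover have "32 * card I \<le> k" using I unfolding k by linarith
      moreover have "64 * d \<le> n" "8 * k \<le> n" using d(2) kn by linarith+
      \<comment> \<open>The terms with \<open>k\<close> total at most
        \<open>2 * (1 + 1/2 + 1/32 + 1/32) * k\<close>, below \<open>n / 2\<close> as
        \<open>8 * k\<close> \<le> \<open>n\<close>; the term \<open>2 * d\<close> is at most
        \<open>n / 32\<close>.\<close>
      ultimately show "2 * (card V + k div 2 + card I + card J + d) \<le> n"
        using V by simp
    qed (use d in \<open>auto simp: k_def\<close>)
    also have "\<dots> \<le> (2 * x) ^ (k div 2) * real (card ?E)"
      using V n by (intro mult_right_mono power_mono) (auto simp: x_def divide_right_mono)
    \<comment> \<open>If \<open>card ?E\<close> is 0, the quotient is 0 by the convention for
      division by zero.\<close>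
    finally show ?thesis
      by (cases "card ?E = 0") (auto simp: x_def divide_le_eq)
  qed
  also have "\<dots> \<le> exp (- (1 / 8) * real k * ln (1 / x))"
    using k2 kn n by (intro power_div2_le_exp) (auto simp: x_def field_simps)
  finally show ?thesis
    unfolding cond_prob_random_digraph[OF E] F_def[symmetric] mult.assoc k
    by (simp add: x_def mult.assoc)
qed

theorem theoremB:
  "\<exists>c c\<^sub>1 :: real. c > 0 \<and> c\<^sub>1 > 0 \<and>
    (\<forall>(n::nat) (d::nat) (I::nat set) (J::nat set) (a :: nat \<Rightarrow> nat \<Rightarrow> nat).
      n > 0 \<longrightarrow> 32 \<le> d \<longrightarrow> real d \<le> c * real n \<longrightarrow>
      I \<subseteq> {1..n} \<longrightarrow> J \<subseteq> {1..n} \<longrightarrow> I \<inter> J = {} \<longrightarrow>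
      real (card I) \<le> real d * real (card J) / 32 \<longrightarrow>
      8 \<le> card J \<longrightarrow> real (card J) \<le> 8 * c * real n / real d \<longrightarrow>
      (\<forall>i\<in>I. a i \<in> bit_vectors n) \<longrightarrow>
      measure_pmf.prob (random_digraph n d) (nbr_event n d I a) \<noteq> 0 \<longrightarrow>
      (\<forall>v\<in>bit_vectors n.
        \<P>(G in measure_pmf (random_digraph n d). delta n J G = v \<bar> G \<in> nbr_event n d I a)
          \<le> 2 * exp (- c\<^sub>1 * real d * real (card J) * ln (real n / (real d * real (card J))))))"
  \<comment> \<open>The witnesses are \<open>c\<close> = 1/64 and \<open>c\<^sub>1\<close> = 1/8;
    \<open>cond_prob_delta_le\<close> has factor 1 in front of the exponential, which is positive,
    so factor 2 follows.\<close>
  by (intro exI[of _ "1 / 64"] exI[of _ "1 / 8"] conjI allI impI ballI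
      order.trans[OF cond_prob_delta_le]) simp_all

end
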